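(* Let $G$ be a connected simple graph that is 2-line existentially closed. Let $G\vee x$ be the graph obtained from $G$ by adding a new vertex $x$ adjacent to every vertex of $G$. Then $G\vee x$ is 2-line existentially closed.
   Context: Two distinct edges of a graph are adjacent if they share at least one end vertex. A graph with at least two edges is 2-line existentially closed (2-line e.c.) if, for all disjoint sets of edges $A$ and $B$ with $|A\cup B|=2$ (either may be empty), there is an edge $e\notin A\cup B$ that is adjacent to each edge of $A$ and to no edge of $B$. *)

theory Defs
  imports Main
begin

text \<open>
  A simple graph has a vertex set and a set of edges, each edge being the two-element set of its
  end vertices. Graphs may be infinite.
\<close>

record 'a sgraph =
  verts :: "'a set"
  edges :: "'a set set"

definition simple_graph :: "'a sgraph \<Rightarrow> bool" where
  "simple_graph G \<longleftrightarrow> (\<forall>e\<in>edges G. e \<subseteq> verts G \<and> card e = 2)"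

definition connected_graph :: "'a sgraph \<Rightarrow> bool" where
  "connected_graph G \<longleftrightarrow> verts G \<noteq> {} \<and>
     (\<forall>u\<in>verts G. \<forall>v\<in>verts G. (u, v) \<in> {(a, b). {a, b} \<in> edges G}\<^sup>*)"

definition edge_adjacent :: "'a set \<Rightarrow> 'a set \<Rightarrow> bool" where
  "edge_adjacent e f \<longleftrightarrow> e \<noteq> f \<and> e \<inter> f \<noteq> {}"

text \<open>The first conjunct says that there are at least two edges (\<open>card\<close> would be 0 on infinite
  edge sets).\<close>

definition two_line_ec :: "'a sgraph \<Rightarrow> bool" where
  "two_line_ec G \<longleftrightarrow>
     (\<exists>e\<in>edges G. \<exists>f\<in>edges G. e \<noteq> f) \<and>
     (\<forall>A B. A \<subseteq> edges G \<and> B \<subseteq> edges G \<and> A \<inter> B = {} \<and> card (A \<union> B) = 2 \<longrightarrow>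
        (\<exists>e\<in>edges G. e \<notin> A \<union> B \<and>
           (\<forall>a\<in>A. edge_adjacent e a) \<and> (\<forall>b\<in>B. \<not> edge_adjacent e b)))"

text \<open>The graph obtained by joining \<open>x\<close> to every vertex; meaningful only for \<open>x \<notin> verts G\<close>.\<close>

definition join_vertex :: "'a sgraph \<Rightarrow> 'a \<Rightarrow> 'a sgraph" where
  "join_vertex G x =
     \<lparr>verts = insert x (verts G), edges = edges G \<union> {{x, v} | v. v \<in> verts G}\<rparr>"

lemma simple_graph_join_vertex:
  assumes "simple_graph G" and "x \<notin> verts G"
  shows "simple_graph (join_vertex G x)"
  using assms unfolding simple_graph_def join_vertex_def
  by (auto simp: card_insert_if)

end

theory Submission
  imports Defs
begin

text \<open>
  By connectedness every vertex \<open>u\<close> of \<open>G\<close> lies on some edge \<open>e\<close>, so that avoiding \<open>u\<close> can be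
  enforced by asking for an edge disjoint from \<open>e\<close>. Hence the existential closure of \<open>G\<close> carries
  over from pairs of edges to pairs consisting of an edge and a vertex, or of two vertices. These
  are exactly the traces on \<open>G\<close> of pairs of edges of the join that contain a star edge at \<open>x\<close>.
\<close>

text \<open>A partition of two edges into \<open>A\<close> and \<open>B\<close> has sizes 2+0, 1+1
  or 0+2, which gives the three clauses. Edges are nonempty, so being disjoint from \<open>f\<close>
  already rules out being \<open>f\<close>; disjointness thus replaces both non-adjacency and
  \<open>g \<notin> A \<union> B\<close>.\<close>

lemma two_line_ec_iff:
  assumes "simple_graph G"
  shows "two_line_ec G \<longleftrightarrow>
    (\<exists>e\<in>edges G. \<exists>f\<in>edges G. e \<noteq> f) \<and>
    (\<forall>e\<in>edges G. \<forall>f\<in>edges G. e \<noteq> f \<longrightarrow>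
      (\<exists>g\<in>edges G. edge_adjacent g e \<and> edge_adjacent g f) \<and>
      (\<exists>g\<in>edges G. edge_adjacent g e \<and> g \<inter> f = {}) \<and>
      (\<exists>g\<in>edges G. g \<inter> e = {} \<and> g \<inter> f = {}))" (is "_ \<longleftrightarrow> ?two \<and> ?pairs")
proof -
  have nonempty: "e \<noteq> {}" if "e \<in> edges G" for e
    using that assms unfolding simple_graph_def by force
  have disjoint_iff: "g \<noteq> f \<and> \<not> edge_adjacent g f \<longleftrightarrow> g \<inter> f = {}" if "f \<in> edges G" for f g
    using nonempty[OF that] by (auto simp: edge_adjacent_def)
  show ?thesis
  proof (intro iffI conjI)
    assume ec: "two_line_ec G"
    then show ?two
      unfolding two_line_ec_def by (rule conjunct1)
    have witness: "\<exists>g\<in>edges G. g \<notin> A \<union> B \<and>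
        (\<forall>a\<in>A. edge_adjacent g a) \<and> (\<forall>b\<in>B. \<not> edge_adjacent g b)"
      if "A \<subseteq> edges G" "B \<subseteq> edges G" "A \<inter> B = {}" "card (A \<union> B) = 2" for A B
      using ec that unfolding two_line_ec_def by blast
    show ?pairs
    proof (intro ballI impI)
      fix e f
      assume ef: "e \<in> edges G" "f \<in> edges G" "e \<noteq> f"
      note disjoint_ef = disjoint_iff[OF ef(1), symmetric] disjoint_iff[OF ef(2), symmetric]
      have "\<exists>g\<in>edges G. edge_adjacent g e \<and> edge_adjacent g f"
        using witness[of "{e, f}" "{}"] ef by auto
      moreover have "\<exists>g\<in>edges G. edge_adjacent g e \<and> g \<inter> f = {}"
        using witness[of "{e}" "{f}"] ef unfolding disjoint_ef by auto
      moreover have "\<exists>g\<in>edges G. g \<inter> e = {} \<and> g \<inter> f = {}"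
        using witness[of "{}" "{e, f}"] ef unfolding disjoint_ef by auto
      ultimately show "(\<exists>g\<in>edges G. edge_adjacent g e \<and> edge_adjacent g f) \<and>
        (\<exists>g\<in>edges G. edge_adjacent g e \<and> g \<inter> f = {}) \<and>
        (\<exists>g\<in>edges G. g \<inter> e = {} \<and> g \<inter> f = {})"
        by blast
    qed
  next
    assume two_pairs: "?two \<and> ?pairs"
    show "two_line_ec G"
      unfolding two_line_ec_def
    proof (intro conjI allI impI)
      show ?two
        using two_pairs by (rule conjunct1)
      fix A B
      assume AB: "A \<subseteq> edges G \<and> B \<subseteq> edges G \<and> A \<inter> B = {} \<and> card (A \<union> B) = 2"
      then obtain e f where ef: "A \<union> B = {e, f}" "e \<noteq> f"
        by (auto simp: card_2_iff)
      then have edges: "e \<in> edges G" "f \<in> edges G"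
        using AB by auto
      have adjacent_both: "\<exists>g\<in>edges G. edge_adjacent g e \<and> edge_adjacent g f"
        \<comment> \<open>The clauses range over ordered pairs, so exchanging \<open>e\<close> and
          \<open>f\<close> gives the second of these facts.\<close>
        and adjacent_one: "\<exists>g\<in>edges G. edge_adjacent g e \<and> g \<inter> f = {}"
          "\<exists>g\<in>edges G. edge_adjacent g f \<and> g \<inter> e = {}"
        and disjoint_both: "\<exists>g\<in>edges G. g \<inter> e = {} \<and> g \<inter> f = {}"
        using two_pairs edges ef(2) by blast+
      note disjoint_ef = disjoint_iff[OF edges(1), symmetric] disjoint_iff[OF edges(2), symmetric]
      have B_eq: "B = {e, f} - A"
        using ef(1) AB by blast
      have "A \<in> Pow {e, f}"
        using ef(1) by blast
      then consider "A = {e, f}" "B = {}" | "A = {e}" "B = {f}" | "A = {f}" "B = {e}"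
        | "A = {}" "B = {e, f}"
        using ef(2) unfolding B_eq by (auto simp: Pow_insert insert_Diff_if insert_commute)
      then show "\<exists>g\<in>edges G. g \<notin> A \<union> B \<and>
          (\<forall>a\<in>A. edge_adjacent g a) \<and> (\<forall>b\<in>B. \<not> edge_adjacent g b)"
      proof cases
        case 1
        then show ?thesis
          using adjacent_both by (auto simp: edge_adjacent_def)
      next
        case 2
        then show ?thesis
          using adjacent_one(1) unfolding disjoint_ef by (auto simp: edge_adjacent_def)
      next
        case 3
        then show ?thesis
          using adjacent_one(2) unfolding disjoint_ef by (auto simp: edge_adjacent_def)
      next
        case 4
        then show ?thesis
          using disjoint_both unfolding disjoint_ef by auto
      qed
    qed
  qed
qed

text \<open>Some edge exists, and one of its two ends differs from \<open>u\<close>; a path from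
  \<open>u\<close> to that end must start with an edge at \<open>u\<close>.\<close>

lemma connected_graph_edge_at_vertex:
  assumes "simple_graph G" "connected_graph G" "edges G \<noteq> {}" "u \<in> verts G"
  obtains e where "e \<in> edges G" "u \<in> e"
proof -
  obtain f where f: "f \<in> edges G"
    using assms(3) by blast
  then have "f \<subseteq> verts G" "card f = 2"
    using assms(1) by (auto simp: simple_graph_def)
  then obtain v where v: "v \<in> verts G" "v \<noteq> u"
    by (auto simp: card_2_iff)
  have "(u, v) \<in> {(a, b). {a, b} \<in> edges G}\<^sup>*"
    using assms(2,4) v(1) unfolding connected_graph_def by blast
  then obtain w where "{u, w} \<in> edges G"
    using v(2) by (auto elim: converse_rtranclE)
  then show thesis
    using that by blast
qed

section \<open>Existential closure for edges and vertices of \<open>G\<close>\<close>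

locale connected_two_line_ec =
  fixes G :: "'a sgraph"
  assumes simple: "simple_graph G"
    and connected: "connected_graph G"
    and ec: "two_line_ec G"
begin

lemma edge_at:
  assumes "u \<in> verts G"
  obtains e where "e \<in> edges G" "u \<in> e"
  using connected_graph_edge_at_vertex[OF simple connected _ assms] ec
  unfolding two_line_ec_def by blast

lemma edge_ends:
  assumes "e \<in> edges G"
  obtains a b where "e = {a, b}" "a \<noteq> b" "a \<in> verts G" "b \<in> verts G"
  using assms simple unfolding simple_graph_def by (auto simp: card_2_iff)

lemma other_edge:
  obtains f where "f \<in> edges G" "f \<noteq> e"
  using ec unfolding two_line_ec_def by metis

lemma pair_witnesses:
  assumes "e \<in> edges G" "f \<in> edges G" "e \<noteq> f"
  shows "\<exists>g\<in>edges G. edge_adjacent g e \<and> edge_adjacent g f"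
    and "\<exists>g\<in>edges G. edge_adjacent g e \<and> g \<inter> f = {}"
    and "\<exists>g\<in>edges G. g \<inter> e = {} \<and> g \<inter> f = {}"
  using assms ec two_line_ec_iff[OF simple] by blast+

text \<open>If \<open>u\<close> lies on \<open>e\<close>, disjointness from \<open>e\<close>
  suffices and the second edge is arbitrary. Otherwise an edge at \<open>u\<close> is distinct from
  \<open>e\<close> and can serve as the second edge.\<close>

lemma edge_disjoint_avoiding:
  assumes "e \<in> edges G" "u \<in> verts G"
  obtains g where "g \<in> edges G" "g \<inter> e = {}" "u \<notin> g"
proof (cases "u \<in> e")
  case True
  obtain f where "f \<in> edges G" "f \<noteq> e"
    by (rule other_edge)
  then show thesis
    using pair_witnesses(3)[of e f] assms(1) True that by blast
next
  case False
  obtain f where "f \<in> edges G" "u \<in> f"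
    by (rule edge_at[OF assms(2)])
  then show thesis
    using pair_witnesses(3)[of e f] assms(1) False that by blast
qed

text \<open>In effect, no vertex has degree one. The only hard case is that the edge found at
  \<open>u\<close> is \<open>{u, v}\<close>; a neighbouring edge then either passes through
  \<open>u\<close> itself or blocks \<open>v\<close>, which forces a further edge through
  \<open>u\<close>.\<close>

lemma edge_through_avoiding:
  assumes "u \<in> verts G" "v \<noteq> u"
  obtains g where "g \<in> edges G" "u \<in> g" "v \<notin> g"
proof -
  obtain e where e: "e \<in> edges G" "u \<in> e"
    by (rule edge_at[OF assms(1)])
  show thesis
  proof (cases "v \<in> e")
    case False
    then show thesis
      using e that by blast
  next
    case True
    then have e_eq: "e = {u, v}"
      using e assms(2) by (auto elim!: edge_ends)
    obtain h where "h \<in> edges G" "h \<noteq> e"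
      by (rule other_edge)
    \<comment> \<open>The edge \<open>h\<close> only completes a pair; what is kept is that
      \<open>f\<close> is adjacent to \<open>e\<close>.\<close>
    then obtain f where f: "f \<in> edges G" "f \<noteq> e" "f \<inter> e \<noteq> {}"
      using pair_witnesses(1)[of e h] e(1) by (auto simp: edge_adjacent_def)
    show thesis
    proof (cases "v \<in> f")
      case False
      then show thesis
        using f e_eq that by blast
    next
      case True
      \<comment> \<open>an edge meeting \<open>{u, v}\<close> but not \<open>f\<close> can only pass through \<open>u\<close>\<close>
      obtain g where "g \<in> edges G" "edge_adjacent g e" "g \<inter> f = {}"
        using pair_witnesses(2)[of e f] e(1) f by blast
      then show thesis
        using True e_eq that by (auto simp: edge_adjacent_def)
    qed
  qed
qed

text \<open>If \<open>u\<close> is an end of \<open>e\<close>, an edge through the other end that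
  misses \<open>u\<close> is adjacent to \<open>e\<close>. Otherwise an edge at \<open>u\<close> is
  distinct from \<open>e\<close>, and avoiding it avoids \<open>u\<close>.\<close>

lemma edge_adjacent_avoiding:
  assumes "e \<in> edges G" "u \<in> verts G"
  obtains g where "g \<in> edges G" "edge_adjacent g e" "u \<notin> g"
proof (cases "u \<in> e")
  case True
  then obtain v where v: "v \<in> e" "v \<in> verts G" "u \<noteq> v"
    using assms(1) by (auto elim!: edge_ends)
  obtain g where "g \<in> edges G" "v \<in> g" "u \<notin> g"
    by (rule edge_through_avoiding[OF v(2,3)])
  then show thesis
    using v(1) True that by (auto simp: edge_adjacent_def)
next
  case False
  obtain f where "f \<in> edges G" "u \<in> f"
    by (rule edge_at[OF assms(2)])
  then show thesis
    using pair_witnesses(2)[of e f] assms(1) False that by blast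
qed

lemma edge_avoiding:
  assumes "u \<in> verts G" "v \<in> verts G"
  obtains g where "g \<in> edges G" "u \<notin> g" "v \<notin> g"
proof -
  obtain e where "e \<in> edges G" "u \<in> e"
    by (rule edge_at[OF assms(1)])
  then show thesis
    using edge_disjoint_avoiding[of e v] assms(2) that by blast
qed

section \<open>Witnesses in the join\<close>

context
  fixes x :: 'a
  assumes x: "x \<notin> verts G"
begin

lemma edges_join_vertex: "edges (join_vertex G x) = edges G \<union> {{x, v} | v. v \<in> verts G}"
  by (simp add: join_vertex_def)

lemma x_notin_edge: "e \<in> edges G \<Longrightarrow> x \<notin> e"
  using simple x unfolding simple_graph_def by blast

text \<open>An edge of \<open>G\<close> misses \<open>{x, u}\<close> exactly when it misses
  \<open>u\<close>, and \<open>{x, w}\<close> with \<open>w \<in> verts G\<close> meets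
  \<open>e\<close> exactly when \<open>w \<in> e\<close>. The mixed condition is needed in both
  directions, as the two edges are of different kinds.\<close>

lemma edge_star_witnesses:
  assumes e: "e \<in> edges G" and u: "u \<in> verts G"
  shows "\<exists>g\<in>edges (join_vertex G x). edge_adjacent g e \<and> edge_adjacent g {x, u}"
    and "\<exists>g\<in>edges (join_vertex G x). edge_adjacent g e \<and> g \<inter> {x, u} = {}"
    and "\<exists>g\<in>edges (join_vertex G x). edge_adjacent g {x, u} \<and> g \<inter> e = {}"
    and "\<exists>g\<in>edges (join_vertex G x). g \<inter> e = {} \<and> g \<inter> {x, u} = {}"
proof -
  obtain v where v: "v \<in> e" "v \<noteq> u" "v \<in> verts G"
    using e by (auto elim!: edge_ends)
  show "\<exists>g\<in>edges (join_vertex G x). edge_adjacent g e \<and> edge_adjacent g {x, u}"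
    using v x_notin_edge[OF e]
    by (intro bexI[of _ "{x, v}"]) (auto simp: edges_join_vertex edge_adjacent_def doubleton_eq_iff)
  obtain g where "g \<in> edges G" "edge_adjacent g e" "u \<notin> g"
    by (rule edge_adjacent_avoiding[OF e u])
  then show "\<exists>g\<in>edges (join_vertex G x). edge_adjacent g e \<and> g \<inter> {x, u} = {}"
    using x_notin_edge by (intro bexI[of _ g]) (auto simp: edges_join_vertex)
  obtain h where h: "h \<in> edges G" "h \<inter> e = {}" "u \<notin> h"
    by (rule edge_disjoint_avoiding[OF e u])
  then show "\<exists>g\<in>edges (join_vertex G x). g \<inter> e = {} \<and> g \<inter> {x, u} = {}"
    using x_notin_edge by (intro bexI[of _ h]) (auto simp: edges_join_vertex)
  \<comment> \<open>An end of \<open>h\<close> lies off \<open>e\<close> and differs from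
    \<open>u\<close>, so \<open>{x, w}\<close> misses \<open>e\<close> and meets
    \<open>{x, u}\<close> in \<open>x\<close> only.\<close>
  obtain w where w: "w \<in> h" "w \<in> verts G"
    using h(1) by (auto elim!: edge_ends)
  then show "\<exists>g\<in>edges (join_vertex G x). edge_adjacent g {x, u} \<and> g \<inter> e = {}"
    using h x_notin_edge[OF e]
    by (intro bexI[of _ "{x, w}"]) (auto simp: edges_join_vertex edge_adjacent_def doubleton_eq_iff)
qed

lemma star_star_witnesses:
  assumes u: "u \<in> verts G" and v: "v \<in> verts G" and "v \<noteq> u"
  shows "\<exists>g\<in>edges (join_vertex G x). edge_adjacent g {x, u} \<and> edge_adjacent g {x, v}"
    and "\<exists>g\<in>edges (join_vertex G x). edge_adjacent g {x, u} \<and> g \<inter> {x, v} = {}"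
    and "\<exists>g\<in>edges (join_vertex G x). g \<inter> {x, u} = {} \<and> g \<inter> {x, v} = {}"
proof -
  obtain h where h: "h \<in> edges G" "u \<notin> h" "v \<notin> h"
    by (rule edge_avoiding[OF u v])
  then show "\<exists>g\<in>edges (join_vertex G x). g \<inter> {x, u} = {} \<and> g \<inter> {x, v} = {}"
    using x_notin_edge by (intro bexI[of _ h]) (auto simp: edges_join_vertex)
  \<comment> \<open>Distinct star edges always meet at \<open>x\<close>, so it is enough that
    \<open>w\<close> differs from \<open>u\<close> and \<open>v\<close>.\<close>
  obtain w where "w \<in> h" "w \<in> verts G"
    using h(1) by (auto elim!: edge_ends)
  then show "\<exists>g\<in>edges (join_vertex G x). edge_adjacent g {x, u} \<and> edge_adjacent g {x, v}"
    using h
    by (intro bexI[of _ "{x, w}"]) (auto simp: edges_join_vertex edge_adjacent_def doubleton_eq_iff)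
  \<comment> \<open>Every star edge meets \<open>{x, v}\<close>, so this witness must come from
    \<open>G\<close> and meet \<open>{x, u}\<close> in \<open>u\<close>.\<close>
  obtain g where "g \<in> edges G" "u \<in> g" "v \<notin> g"
    by (rule edge_through_avoiding[OF u \<open>v \<noteq> u\<close>])
  then show "\<exists>g\<in>edges (join_vertex G x). edge_adjacent g {x, u} \<and> g \<inter> {x, v} = {}"
    using x_notin_edge by (intro bexI[of _ g]) (auto simp: edges_join_vertex edge_adjacent_def)
qed

lemma two_line_ec_join_vertex: "two_line_ec (join_vertex G x)"
  unfolding two_line_ec_iff[OF simple_graph_join_vertex[OF simple x]]
proof (rule conjI, goal_cases)
  case 1
  show ?case
    using ec unfolding two_line_ec_def edges_join_vertex by blast
next
  case 2
  show ?case
  proof (intro ballI impI)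
    fix e f
    assume ef: "e \<in> edges (join_vertex G x)" "f \<in> edges (join_vertex G x)" "e \<noteq> f"
    then consider "e \<in> edges G" "f \<in> edges G"
      | u where "e \<in> edges G" "f = {x, u}" "u \<in> verts G"
      | u where "e = {x, u}" "f \<in> edges G" "u \<in> verts G"
      | u v where "e = {x, u}" "f = {x, v}" "u \<in> verts G" "v \<in> verts G"
      unfolding edges_join_vertex by blast
    then show "(\<exists>g\<in>edges (join_vertex G x). edge_adjacent g e \<and> edge_adjacent g f) \<and>
      (\<exists>g\<in>edges (join_vertex G x). edge_adjacent g e \<and> g \<inter> f = {}) \<and>
      (\<exists>g\<in>edges (join_vertex G x). g \<inter> e = {} \<and> g \<inter> f = {})"
    proof cases
      \<comment> \<open>Adjacency does not depend on the ambient graph, so witnesses in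
        \<open>G\<close> remain valid in the join.\<close>
      case 1
      then show ?thesis
        using pair_witnesses[OF 1 ef(3)] unfolding edges_join_vertex by blast
    next
      case (2 u)
      then show ?thesis
        using edge_star_witnesses[of e u] by blast
    next
      \<comment> \<open>With the roles exchanged, the mixed clause is now the third fact of
        \<open>edge_star_witnesses\<close>.\<close>
      case (3 u)
      then show ?thesis
        using edge_star_witnesses[of f u] by blast
    next
      case (4 u v)
      then have "v \<noteq> u"
        using ef(3) by blast
      then show ?thesis
        using star_star_witnesses[of u v] 4 by blast
    qed
  qed
qed

end

end

theorem theorem5:
  fixes G :: "'a sgraph" and x :: 'a
  assumes "simple_graph G"
    and "connected_graph G"
    and "two_line_ec G"
    and "x \<notin> verts G"
  shows "two_line_ec (join_vertex G x)"
proof -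
  interpret connected_two_line_ec G
    using assms(1-3) by unfold_locales
  show ?thesis
    using assms(4) by (rule two_line_ec_join_vertex)
qed

end
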